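(* Let $\mathcal{S}$ be a probabilistic transition system, let $T$ be a search of $\mathcal{S}$, and let $\phi$ be an LTL$_+$ formula. If $T$ has not found a violation of $\phi$, then \[ \mu_{\mathcal{S}_T}\bigl(\mathcal{B}^{\phi}_{\mathcal{S}_T}(T)\bigr)=\mu_{\mathcal{S}_T}\bigl(\{\, e\in\mathrm{Exec}_{\mathcal{S}_T}\mid e\models_{\mathcal{S}_T}\phi\,\}\bigr). \]
   Context: A probabilistic transition system (PTS) $\mathcal{S}$ consists of a countable set $S_{\mathcal{S}}$ of states, a countable set $T_{\mathcal{S}}$ of transitions, a set $AP$ of atomic propositions, an initial state $s_0\in S_{\mathcal{S}}$, functions $\mathrm{source}_{\mathcal{S}},\mathrm{target}_{\mathcal{S}}:T_{\mathcal{S}}\to S_{\mathcal{S}}$, $\mathrm{prob}_{\mathcal{S}}:T_{\mathcal{S}}\to(0,1]$ and $\mathrm{label}_{\mathcal{S}}:S_{\mathcal{S}}\to 2^{AP}$, such that for every $s$, $\sum\{\mathrm{prob}_{\mathcal{S}}(t)\mid \mathrm{source}_{\mathcal{S}}(t)=s\}=1$. An execution path is an infinite sequence $t_1t_2\ldots$ of transitions with $\mathrm{source}(t_1)=s_0$ and $\mathrm{target}(t_i)=\mathrm{source}(t_{i+1})$; $\mathrm{Exec}_{\mathcal{S}}$ is the set of execution paths. For a finite sequence $e$ of transitions, $B^e_{\mathcal{S}}$ is the set of execution paths having $e$ as a prefix. $\mu_{\mathcal{S}}$ is the probability measure on the $\sigma$-algebra generated by these sets with $\mu_{\mathcal{S}}(B^{t_1\ldots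 t_n}_{\mathcal{S}})=\prod_{i=1}^n\mathrm{prob}_{\mathcal{S}}(t_i)$ for finite prefixes of execution paths. The trace of $t_1t_2\ldots$ is $\mathrm{label}(\mathrm{source}(t_1))\,\mathrm{label}(\mathrm{source}(t_2))\ldots$; for a linear-time property $\phi$ (set of infinite words over $2^{AP}$; LTL formulas identified with their sets of models), $e\models_{\mathcal{S}}\phi$ means the trace of $e$ satisfies $\phi$. A search of $\mathcal{S}$ is a finite subset $T\subseteq T_{\mathcal{S}}$. A PTS $\mathcal{S}'$ extends the search $T$ of $\mathcal{S}$ if it has the same initial state and every $t\in T$ is a transition of $\mathcal{S}'$ with the same source, target and probability as in $\mathcal{S}$, with the labels of its source and target unchanged. For such $\mathcal{S}'$, $\mathcal{B}^{\phi}_{\mathcal{S}'}(T)=\bigcup\{B^e_{\mathcal{S}'}\mid e\in T^*,\ \forall e'\in B^e_{\mathcal{S}'}: e'\models_{\mathcal{S}'}\phi\}$. The search $T$ has not found a violation of $\phi$ if there is a PTS $\mathcal{S}'$ extending $T$ of $\mathcal{S}$ such that $e\models_{\mathcal{S}'}\phi$ for all $e\in\mathrm{Exec}_{\mathcal{S}'}$. The PTS $\mathcal{S}_T$: with $S^T=\{\mathrm{source}_{\mathcal{S}}(t),\mathrm{target}_{\mathcal{S}}(t)\mid t\in T\}\cup\{s_0\}$ and $\mathrm{out}(s)=\sum\{\mathrm{prob}_{\mathcal{S}}(t)\mid t\in T,\ \mathrm{source}_{\mathcal{S}}(t)=s\}$, $\mathcal{S}_T$ has states $S^T\cup\{s_\perp\}$,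 transitions $T\cup\{t_s\mid s\in S^T,\ \mathrm{out}(s)<1\}\cup\{t_\perp\}$, initial state $s_0$; transitions in $T$ keep their data from $\mathcal{S}$; $t_s$ goes from $s$ to $s_\perp$ with probability $1-\mathrm{out}(s)$; $t_\perp$ is a self-loop on $s_\perp$ with probability $1$; $\mathrm{label}(s_\perp)=\emptyset$, other labels as in $\mathcal{S}$. LTL$_+$ formulas: $\phi::=\mathrm{true}\mid\mathrm{false}\mid a\mid\phi\wedge\phi\mid\phi\vee\phi\mid\bigcirc\phi\mid\phi_1\mathbin{\mathcal{U}}\phi_2\mid\phi_1\mathbin{\mathcal{R}}\phi_2$ with $a\in AP$, standard LTL semantics. *)

theory Defs
  imports "HOL-Probability.Probability" "HOL-Library.Stream"
begin

text \<open>
  The type \<open>'a\<close> plays the role of the set of atomic propositions. States and transitions are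
  sets inside the types \<open>'s\<close> and \<open>'t\<close>; the values of the functions outside these sets are
  irrelevant.
\<close>

record ('s, 't, 'a) pts =
  states :: "'s set"
  transitions :: "'t set"
  initial :: 's
  source :: "'t \<Rightarrow> 's"
  target :: "'t \<Rightarrow> 's"
  prob :: "'t \<Rightarrow> real"
  label :: "'s \<Rightarrow> 'a set"

definition is_pts :: "('s, 't, 'a) pts \<Rightarrow> bool" where
  "is_pts S \<longleftrightarrow>
     countable (states S) \<and> countable (transitions S) \<and>
     initial S \<in> states S \<and>
     (\<forall>t\<in>transitions S. source S t \<in> states S \<and> target S t \<in> states S \<and>
        0 < prob S t \<and> prob S t \<le> 1) \<and>
     (\<forall>s\<in>states S. (prob S has_sum 1) {t \<in> transitions S. source S t = s})"

definition Exec :: "('s, 't, 'a) pts \<Rightarrow> 't stream set" where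
  "Exec S = {w. sset w \<subseteq> transitions S \<and> source S (shd w) = initial S \<and>
     (\<forall>i. target S (w !! i) = source S (w !! Suc i))}"

definition cyl :: "('s, 't, 'a) pts \<Rightarrow> 't list \<Rightarrow> 't stream set" where
  "cyl S e = {w \<in> Exec S. stake (length e) w = e}"

definition finite_prefixes :: "('s, 't, 'a) pts \<Rightarrow> 't list set" where
  "finite_prefixes S = {stake n w | n w. w \<in> Exec S}"

text \<open>
  The sequences that are not prefixes of an execution path have an empty cylinder, so leaving
  them out does not change the generated sigma-algebra (lemma \<open>sets_path_measure\<close> below). The
  default case of \<^const>\<open>extend_measure\<close> does not occur: lemmas \<open>emeasure_path_measure_cyl\<close> and
  \<open>prob_space_path_measure\<close>.
\<close>

definition path_measure :: "('s, 't, 'a) pts \<Rightarrow> 't stream measure" where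
  "path_measure S = extend_measure (Exec S) (finite_prefixes S) (cyl S)
     (\<lambda>e. ennreal (\<Prod>t\<leftarrow>e. prob S t))"

definition path_trace :: "('s, 't, 'a) pts \<Rightarrow> 't stream \<Rightarrow> 'a set stream" where
  "path_trace S w = smap (\<lambda>t. label S (source S t)) w"

definition satisfies :: "('s, 't, 'a) pts \<Rightarrow> 't stream \<Rightarrow> 'a set stream set \<Rightarrow> bool" where
  "satisfies S w P \<longleftrightarrow> path_trace S w \<in> P"

definition is_search :: "('s, 't, 'a) pts \<Rightarrow> 't set \<Rightarrow> bool" where
  "is_search S T \<longleftrightarrow> finite T \<and> T \<subseteq> transitions S"

text \<open>
  Two systems need not live in the same types. The embeddings \<open>i\<close> and \<open>j\<close>, always injective
  where this is used, identify the states and transitions of \<open>S\<close> with elements of the types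
  of \<open>S'\<close>.
\<close>

definition extends_via ::
  "('s \<Rightarrow> 's2) \<Rightarrow> ('t \<Rightarrow> 't2) \<Rightarrow> ('s, 't, 'a) pts \<Rightarrow> 't set \<Rightarrow> ('s2, 't2, 'a) pts \<Rightarrow> bool" where
  "extends_via i j S T S' \<longleftrightarrow>
     initial S' = i (initial S) \<and>
     (\<forall>t\<in>T. j t \<in> transitions S' \<and>
        source S' (j t) = i (source S t) \<and>
        target S' (j t) = i (target S t) \<and>
        prob S' (j t) = prob S t \<and>
        label S' (i (source S t)) = label S (source S t) \<and>
        label S' (i (target S t)) = label S (target S t))"

definition good_paths :: "('s, 't, 'a) pts \<Rightarrow> 't set \<Rightarrow> 'a set stream set \<Rightarrow> 't stream set" where
  "good_paths S' T P = \<Union>{cyl S' e | e. e \<in> lists T \<and> (\<forall>w\<in>cyl S' e. satisfies S' w P)}"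

text \<open>
  An extension may need states and transitions that do not exist in \<open>S\<close>. Since these are
  countably many, the types \<open>'s + nat\<close> and \<open>'t + nat\<close> have room for every extension up to
  isomorphism (lemma \<open>no_violation_foundI\<close> below).
\<close>

definition no_violation_found :: "('s, 't, 'a) pts \<Rightarrow> 't set \<Rightarrow> 'a set stream set \<Rightarrow> bool" where
  "no_violation_found S T P \<longleftrightarrow>
     (\<exists>S' :: ('s + nat, 't + nat, 'a) pts. is_pts S' \<and> extends_via Inl Inl S T S' \<and>
        (\<forall>w\<in>Exec S'. satisfies S' w P))"

definition search_states :: "('s, 't, 'a) pts \<Rightarrow> 't set \<Rightarrow> 's set" where
  "search_states S T = source S ` T \<union> target S ` T \<union> {initial S}"

definition out_prob :: "('s, 't, 'a) pts \<Rightarrow> 't set \<Rightarrow> 's \<Rightarrow> real" where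
  "out_prob S T s = (\<Sum>t | t \<in> T \<and> source S t = s. prob S t)"

text \<open>
  The state \<open>None\<close> is the additional sink; \<open>Missing s\<close> is the transition from \<open>s\<close> to the sink
  and \<open>Sink_Loop\<close> the self-loop on the sink.
\<close>

datatype ('s, 't) search_trans = Found 't | Missing 's | Sink_Loop

definition search_pts :: "('s, 't, 'a) pts \<Rightarrow> 't set \<Rightarrow> ('s option, ('s, 't) search_trans, 'a) pts" where
  "search_pts S T = \<lparr>
     states = Some ` search_states S T \<union> {None},
     transitions = Found ` T \<union> {Missing s | s. s \<in> search_states S T \<and> out_prob S T s < 1}
       \<union> {Sink_Loop},
     initial = Some (initial S),
     source = (\<lambda>u. case u of Found t \<Rightarrow> Some (source S t) | Missing s \<Rightarrow> Some s
       | Sink_Loop \<Rightarrow> None),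
     target = (\<lambda>u. case u of Found t \<Rightarrow> Some (target S t) | Missing s \<Rightarrow> None
       | Sink_Loop \<Rightarrow> None),
     prob = (\<lambda>u. case u of Found t \<Rightarrow> prob S t | Missing s \<Rightarrow> 1 - out_prob S T s
       | Sink_Loop \<Rightarrow> 1),
     label = (\<lambda>s. case s of Some s' \<Rightarrow> label S s' | None \<Rightarrow> {}) \<rparr>"

datatype 'a ltl_pos =
    LTrue
  | LFalse
  | LAtom 'a
  | LAnd "'a ltl_pos" "'a ltl_pos"
  | LOr "'a ltl_pos" "'a ltl_pos"
  | LNext "'a ltl_pos"
  | LUntil "'a ltl_pos" "'a ltl_pos"
  | LRelease "'a ltl_pos" "'a ltl_pos"

primrec ltl_sat :: "'a ltl_pos \<Rightarrow> 'a set stream \<Rightarrow> bool" where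
  "ltl_sat LTrue x \<longleftrightarrow> True"
| "ltl_sat LFalse x \<longleftrightarrow> False"
| "ltl_sat (LAtom a) x \<longleftrightarrow> a \<in> shd x"
| "ltl_sat (LAnd f g) x \<longleftrightarrow> ltl_sat f x \<and> ltl_sat g x"
| "ltl_sat (LOr f g) x \<longleftrightarrow> ltl_sat f x \<or> ltl_sat g x"
| "ltl_sat (LNext f) x \<longleftrightarrow> ltl_sat f (stl x)"
| "ltl_sat (LUntil f g) x \<longleftrightarrow> (\<exists>k. ltl_sat g (sdrop k x) \<and> (\<forall>l<k. ltl_sat f (sdrop l x)))"
| "ltl_sat (LRelease f g) x \<longleftrightarrow> (\<forall>k. ltl_sat g (sdrop k x) \<or> (\<exists>l<k. ltl_sat f (sdrop l x)))"

definition models :: "'a ltl_pos \<Rightarrow> 'a set stream set" where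
  "models f = {x. ltl_sat f x}"

lemma is_pts_search_pts:
  assumes S: "is_pts S" and T: "is_search S T"
  shows "is_pts (search_pts S T)"
proof -
  have finT: "finite T" and subT: "T \<subseteq> transitions S" using T by (auto simp: is_search_def)
  have finS: "finite (search_states S T)" using finT by (simp add: search_states_def)
  have nonneg: "0 \<le> out_prob S T s" for s
    unfolding out_prob_def using S subT by (intro sum_nonneg) (force simp: is_pts_def)
  have le1: "out_prob S T s \<le> 1" if s: "s \<in> states S" for s
  proof -
    have "(prob S has_sum out_prob S T s) {t. t \<in> T \<and> source S t = s}"
      unfolding out_prob_def using finT by (intro has_sum_finite) auto
    moreover have "(prob S has_sum 1) {t \<in> transitions S. source S t = s}"
      using S s by (simp add: is_pts_def)
    ultimately show ?thesis
      by (rule has_sum_mono_neutral) (use subT S in \<open>auto simp: is_pts_def intro: less_imp_le\<close>)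
  qed
  have sub: "search_states S T \<subseteq> states S"
    using S subT by (auto simp: search_states_def is_pts_def)
  have main: "(prob (search_pts S T) has_sum 1)
      {u \<in> transitions (search_pts S T). source (search_pts S T) u = Some s}"
    if s: "s \<in> search_states S T" for s
  proof -
    let ?F = "Found ` {t. t \<in> T \<and> source S t = s}"
    have sumF: "(\<Sum>u\<in>?F. prob (search_pts S T) u) = out_prob S T s"
      unfolding out_prob_def by (subst sum.reindex) (auto simp: search_pts_def inj_on_def)
    have finF: "finite ?F" using finT by auto
    show ?thesis
    proof (cases "out_prob S T s < 1")
      case True
      have eq: "{u \<in> transitions (search_pts S T). source (search_pts S T) u = Some s}
          = insert (Missing s) ?F"
        using True s by (auto simp: search_pts_def)
      have one: "(\<Sum>u\<in>insert (Missing s) ?F. prob (search_pts S T) u) = 1"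
        using finF sumF by (subst sum.insert) (auto simp: search_pts_def)
      have "finite (insert (Missing s) ?F)" using finF by simp
      from has_sum_finite[OF this, of "prob (search_pts S T)"] show ?thesis
        unfolding eq one .
    next
      case False
      then have one: "out_prob S T s = 1" using le1 s sub by force
      have eq: "{u \<in> transitions (search_pts S T). source (search_pts S T) u = Some s} = ?F"
        using False s by (auto simp: search_pts_def)
      from has_sum_finite[OF finF, of "prob (search_pts S T)"] show ?thesis
        unfolding eq sumF one .
    qed
  qed
  have sink: "(prob (search_pts S T) has_sum 1)
      {u \<in> transitions (search_pts S T). source (search_pts S T) u = None}"
  proof -
    have eq: "{u \<in> transitions (search_pts S T). source (search_pts S T) u = None} = {Sink_Loop}"
      by (auto simp: search_pts_def)
    show ?thesis unfolding eq
      using has_sum_finite[of "{Sink_Loop}" "prob (search_pts S T)"] by (simp add: search_pts_def)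
  qed
  have "countable {Missing s | s. s \<in> search_states S T \<and> out_prob S T s < 1}"
    using finS by (intro countable_finite) auto
  then have "countable (transitions (search_pts S T))"
    using finT by (simp add: search_pts_def countable_finite)
  moreover have "\<forall>u\<in>transitions (search_pts S T).
      source (search_pts S T) u \<in> states (search_pts S T) \<and>
      target (search_pts S T) u \<in> states (search_pts S T) \<and>
      0 < prob (search_pts S T) u \<and> prob (search_pts S T) u \<le> 1"
    using S subT nonneg by (auto simp: search_pts_def search_states_def is_pts_def)
  moreover have "\<forall>s\<in>states (search_pts S T). (prob (search_pts S T) has_sum 1)
      {u \<in> transitions (search_pts S T). source (search_pts S T) u = s}"
  proof
    fix s assume "s \<in> states (search_pts S T)"
    then consider "s = None" | s' where "s = Some s'" "s' \<in> search_states S T"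
      by (auto simp: search_pts_def)
    then show "(prob (search_pts S T) has_sum 1)
      {u \<in> transitions (search_pts S T). source (search_pts S T) u = s}"
      by cases (use sink main in auto)
  qed
  moreover have "countable (states (search_pts S T))" "initial (search_pts S T) \<in> states (search_pts S T)"
    using finS by (auto simp: search_pts_def search_states_def countable_finite)
  ultimately show ?thesis unfolding is_pts_def by blast
qed

lemma extends_search_pts: "extends_via Some Found S T (search_pts S T)"
  by (auto simp: extends_via_def search_pts_def)

lemma no_violation_foundI:
  fixes S' :: "('s2, 't2, 'a) pts" and S :: "('s, 't, 'a) pts"
  assumes S': "is_pts S'" and ij: "inj_on i (search_states S T)" "inj_on j T"
    and ext: "extends_via i j S T S'"
    and sat: "\<And>w. w \<in> Exec S' \<Longrightarrow> satisfies S' w P"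
  shows "no_violation_found S T P"
proof -
  define f :: "'s2 \<Rightarrow> 's + nat" where
    "f = (\<lambda>s. if s \<in> i ` search_states S T then Inl (inv_into (search_states S T) i s)
        else Inr (to_nat_on (states S') s))"
  define g :: "'t2 \<Rightarrow> 't + nat" where
    "g = (\<lambda>t. if t \<in> j ` T then Inl (inv_into T j t) else Inr (to_nat_on (transitions S') t))"
  have cS: "countable (states S')" and cT: "countable (transitions S')"
    using S' by (auto simp: is_pts_def)
  have fi: "f (i s) = Inl s" if "s \<in> search_states S T" for s using ij that by (simp add: f_def)
  have gj: "g (j t) = Inl t" if "t \<in> T" for t using ij that by (simp add: g_def)
  have injf: "inj_on f (states S')"
  proof (rule inj_onI)
    fix x y assume xy: "x \<in> states S'" "y \<in> states S'" "f x = f y"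
    then have "x \<in> i ` search_states S T \<longleftrightarrow> y \<in> i ` search_states S T" by (simp add: f_def split: if_splits)
    then show "x = y"
      using xy cS by (cases "x \<in> i ` search_states S T") (simp_all add: f_def inv_into_injective)
  qed
  have injg: "inj_on g (transitions S')"
  proof (rule inj_onI)
    fix x y assume xy: "x \<in> transitions S'" "y \<in> transitions S'" "g x = g y"
    then have "x \<in> j ` T \<longleftrightarrow> y \<in> j ` T" by (simp add: g_def split: if_splits)
    then show "x = y"
      using xy cT by (cases "x \<in> j ` T") (simp_all add: g_def inv_into_injective)
  qed
  define g' where "g' = the_inv_into (transitions S') g"
  define f' where "f' = the_inv_into (states S') f"
  have g': "g' (g t) = t" if "t \<in> transitions S'" for t
    using the_inv_into_f_f[OF injg that] by (simp add: g'_def)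
  have f': "f' (f s) = s" if "s \<in> states S'" for s
    using the_inv_into_f_f[OF injf that] by (simp add: f'_def)
  define R :: "('s + nat, 't + nat, 'a) pts" where
    "R = \<lparr> states = f ` states S', transitions = g ` transitions S', initial = f (initial S'),
       source = (\<lambda>t. f (source S' (g' t))), target = (\<lambda>t. f (target S' (g' t))),
       prob = (\<lambda>t. prob S' (g' t)), label = (\<lambda>s. label S' (f' s)) \<rparr>"
  have st: "source S' t \<in> states S'" "target S' t \<in> states S'" if "t \<in> transitions S'" for t
    using S' that by (auto simp: is_pts_def)
  have ini: "initial S' \<in> states S'" using S' by (simp add: is_pts_def)
  have "is_pts R"
  proof -
    have "(prob R has_sum 1) {t \<in> transitions R. source R t = s}" if sR: "s \<in> states R" for s
    proof -
      obtain s' where s': "s' \<in> states S'" "s = f s'" using sR by (auto simp: R_def)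
      let ?A = "{t \<in> transitions S'. source S' t = s'}"
      have eq: "{t \<in> transitions R. source R t = s} = g ` ?A"
      proof (intro set_eqI iffI)
        fix u assume "u \<in> {t \<in> transitions R. source R t = s}"
        then obtain t where t: "t \<in> transitions S'" "u = g t" "f (source S' t) = f s'"
          using s' g' by (auto simp: R_def)
        then have "source S' t = s'" using inj_onD[OF injf] st s' by blast
        then show "u \<in> g ` ?A" using t by blast
      next
        fix u assume "u \<in> g ` ?A"
        then show "u \<in> {t \<in> transitions R. source R t = s}" using s' g' by (auto simp: R_def)
      qed
      have "inj_on g ?A" using injg by (rule inj_on_subset) auto
      moreover have "((prob R \<circ> g) has_sum 1) ?A \<longleftrightarrow> (prob S' has_sum 1) ?A"
        by (rule has_sum_cong) (simp add: R_def g')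
      moreover have "(prob S' has_sum 1) ?A" using S' s' by (simp add: is_pts_def)
      ultimately show ?thesis unfolding eq by (simp add: has_sum_reindex)
    qed
    then show ?thesis
      using S' cS cT st ini g' by (auto simp: is_pts_def R_def)
  qed
  moreover have "extends_via Inl Inl S T R"
    unfolding extends_via_def
  proof (intro conjI ballI)
    show "initial R = Inl (initial S)" using ext by (simp add: extends_via_def R_def fi search_states_def)
    fix t assume t: "t \<in> T"
    have jt: "j t \<in> transitions S'" and so: "source S' (j t) = i (source S t)"
      and ta: "target S' (j t) = i (target S t)" and pr: "prob S' (j t) = prob S t"
      and ls: "label S' (i (source S t)) = label S (source S t)"
      and lt: "label S' (i (target S t)) = label S (target S t)"
      using ext t by (auto simp: extends_via_def)
    have fst_eq: "f (i (source S t)) = Inl (source S t)" "f (i (target S t)) = Inl (target S t)"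
      using t by (auto intro!: fi simp: search_states_def)
    have gt: "g' (Inl t) = j t" using g'[OF jt] gj[OF t] by simp
    show "Inl t \<in> transitions R" using jt gj[OF t] by (auto simp: R_def intro: rev_image_eqI)
    show "source R (Inl t) = Inl (source S t)" "target R (Inl t) = Inl (target S t)"
      "prob R (Inl t) = prob S t"
      by (simp_all add: R_def gt so ta pr fst_eq)
    have "f' (Inl (source S t)) = i (source S t)" "f' (Inl (target S t)) = i (target S t)"
      using f'[of "i (source S t)"] f'[of "i (target S t)"] st[OF jt] by (simp_all add: so ta fst_eq)
    then show "label R (Inl (source S t)) = label S (source S t)"
      "label R (Inl (target S t)) = label S (target S t)"
      by (simp_all add: R_def ls lt)
  qed
  moreover have "satisfies R w P" if w: "w \<in> Exec R" for w
  proof -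
    have tr: "w !! n \<in> g ` transitions S'" for n
      using w snth_sset[of w n] by (auto simp: Exec_def R_def)
    then have tr': "g' (w !! n) \<in> transitions S'" for n
      using g' by (metis imageE)
    have "smap g' w \<in> Exec S'"
      unfolding Exec_def
    proof (intro CollectI conjI allI)
      show "sset (smap g' w) \<subseteq> transitions S'" using tr' by (auto simp: sset_range)
      have "f (source S' (g' (w !! 0))) = f (initial S')" using w by (simp add: Exec_def R_def)
      then show "source S' (shd (smap g' w)) = initial S'"
        using injf st[OF tr'[of 0]] ini by (auto simp: inj_on_eq_iff)
      fix n
      have "f (target S' (g' (w !! n))) = f (source S' (g' (w !! Suc n)))"
        using w by (simp add: Exec_def R_def)
      then show "target S' (smap g' w !! n) = source S' (smap g' w !! Suc n)"
        using injf st(2)[OF tr'[of n]] st(1)[OF tr'[of "Suc n"]] by (auto simp: inj_on_eq_iff)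
    qed
    moreover have "path_trace R w = path_trace S' (smap g' w)"
      using st(1)[OF tr'] f'
      by (simp add: path_trace_def stream.map_comp)
        (auto intro!: stream.map_cong0 simp: R_def sset_range)
    ultimately show ?thesis using sat by (auto simp: satisfies_def)
  qed
  ultimately show ?thesis unfolding no_violation_found_def by blast
qed

lemma path_measure_exists:
  fixes S :: "('s, 't, 'a) pts"
  assumes S: "is_pts S"
  obtains N where "space N = Exec S" "sets N = sets (path_measure S)" "prob_space N"
    "\<And>e. e \<in> finite_prefixes S \<Longrightarrow> emeasure N (cyl S e) = ennreal (\<Prod>t\<leftarrow>e. prob S t)"
proof -
  define succ where "succ s = {t \<in> transitions S. source S t = s}" for s
  define K :: "nat \<times> 's \<Rightarrow> 't measure" where "K = (\<lambda>(n, s). if s \<in> states S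
    then density (count_space (succ s)) (\<lambda>t. ennreal (prob S t))
    else measure_pmf (return_pmf undefined))"
  have K: "space (K (n, s)) = succ s" "sets (K (n, s)) = Pow (succ s)" if "s \<in> states S" for n s
    using that by (auto simp: K_def)
  have Kprob: "prob_space (K x)" for x
  proof -
    obtain n s where x: "x = (n, s)" by force
    show ?thesis
    proof (cases "s \<in> states S")
      case True
      have hs: "(prob S has_sum 1) (succ s)" using S True by (simp add: is_pts_def succ_def)
      have pos: "0 \<le> prob S t" if "t \<in> succ s" for t
        using S that by (force simp: is_pts_def succ_def)
      have abs: "Infinite_Set_Sum.abs_summable_on (prob S) (succ s)"
        using hs pos by (metis (no_types, lifting) abs_summable_equivalent has_sum_imp_summable real_norm_def abs_of_nonneg summable_on_cong)
      have "(\<integral>\<^sup>+ t. ennreal (prob S t) \<partial>count_space (succ s)) = ennreal (infsetsum (prob S) (succ s))"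
        using abs pos by (rule nn_integral_conv_infsetsum)
      also have "infsetsum (prob S) (succ s) = 1"
        using infsetsum_infsum[OF abs] infsumI[OF hs] by simp
      also have "(\<integral>\<^sup>+ t. ennreal (prob S t) \<partial>count_space (succ s)) =
          (\<integral>\<^sup>+ t. ennreal (prob S t) * indicator (succ s) t \<partial>count_space (succ s))"
        by (rule nn_integral_cong) simp
      finally have "emeasure (K x) (space (K x)) = 1"
        using True by (simp add: x K_def emeasure_density)
      then show ?thesis by (rule prob_spaceI)
    qed (simp add: x K_def measure_pmf.prob_space_axioms)
  qed
  interpret K: product_prob_space K "UNIV \<times> states S"
    using Kprob by (intro product_prob_spaceI)
  have Ksing: "emeasure (K (n, source S t)) {t} = ennreal (prob S t)" if "t \<in> transitions S" for n t
    using that S by (auto simp: K_def is_pts_def emeasure_density succ_def nn_integral_indicator_singleton')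
  define P where "P = Pi\<^sub>M (UNIV \<times> states S) K"
  define st where "st \<omega> = rec_nat (initial S) (\<lambda>n s. target S (\<omega> (n, s)))" for \<omega> :: "nat \<times> 's \<Rightarrow> 't"
  have st0: "st \<omega> 0 = initial S" and stS: "st \<omega> (Suc n) = target S (\<omega> (n, st \<omega> n))" for \<omega> n
    by (simp_all add: st_def)
  define W where "W \<omega> = smap (\<lambda>n. \<omega> (n, st \<omega> n)) nats" for \<omega>
  have Wn: "W \<omega> !! n = \<omega> (n, st \<omega> n)" for \<omega> n by (simp add: W_def)
  have Pin: "\<omega> (n, s) \<in> succ s" if "\<omega> \<in> space P" "s \<in> states S" for \<omega> n s
    using that K[of s n] by (auto simp: P_def space_PiM PiE_def Pi_def)
  have st_in: "st \<omega> n \<in> states S" if \<omega>: "\<omega> \<in> space P" for \<omega> n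
  proof (induction n)
    case 0
    then show ?case using S by (simp add: st0 is_pts_def)
  next
    case (Suc n)
    then show ?case using Pin[OF \<omega> Suc, of n] S by (simp add: stS succ_def is_pts_def)
  qed
  have src: "\<omega> (n, st \<omega> n) \<in> transitions S" "source S (\<omega> (n, st \<omega> n)) = st \<omega> n"
    if \<omega>: "\<omega> \<in> space P" for \<omega> n
    using Pin[OF \<omega> st_in[OF \<omega>], of n n] by (auto simp: succ_def)
  have WE: "W \<omega> \<in> Exec S" if \<omega>: "\<omega> \<in> space P" for \<omega>
    unfolding Exec_def
  proof (intro CollectI conjI allI)
    show "sset (W \<omega>) \<subseteq> transitions S" using src[OF \<omega>] by (auto simp: sset_range Wn)
    show "source S (shd (W \<omega>)) = initial S" using src[OF \<omega>, of 0] Wn[of \<omega> 0] by (simp add: st0)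
    show "target S (W \<omega> !! n) = source S (W \<omega> !! Suc n)" for n
      using src[OF \<omega>, of "Suc n"] by (simp only: Wn stS)
  qed
  have gen: "cyl S ` finite_prefixes S \<subseteq> Pow (Exec S)" by (auto simp: cyl_def)
  have sp: "space (path_measure S) = Exec S"
    and se: "sets (path_measure S) = sigma_sets (Exec S) (cyl S ` finite_prefixes S)"
    unfolding path_measure_def using gen
    by (simp_all add: space_extend_measure sets_extend_measure)
  have main: "W -` cyl S e \<inter> space P \<in> sets P \<and>
      emeasure P (W -` cyl S e \<inter> space P) = ennreal (\<Prod>t\<leftarrow>e. prob S t)"
    if e: "e \<in> finite_prefixes S" for e
  proof -
    obtain n w where w: "w \<in> Exec S" and ew: "e = stake n w" using e by (auto simp: finite_prefixes_def)
    have wt: "w !! k \<in> transitions S" for k using w snth_sset[of w k] by (auto simp: Exec_def)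
    have wS: "source S (w !! k) \<in> states S" for k using wt S by (auto simp: is_pts_def)
    define J where "J = (\<lambda>k. (k, source S (w !! k))) ` {..<n}"
    define X where "X = (\<lambda>(k::nat, s::'s). {w !! k})"
    have J: "J \<subseteq> UNIV \<times> states S" "finite J" using wS by (auto simp: J_def)
    have X: "X x \<in> sets (K x)" if "x \<in> J" for x
      using that wt wS by (auto simp: J_def X_def K succ_def)
    have "W -` cyl S e \<inter> space P = K.emb (UNIV \<times> states S) J (Pi\<^sub>E J X)"
    proof (intro set_eqI iffI)
      fix \<omega> assume a: "\<omega> \<in> W -` cyl S e \<inter> space P"
      then have \<omega>: "\<omega> \<in> space P" and "stake n (W \<omega>) = stake n w"
        by (auto simp: cyl_def ew)
      then have eq: "\<omega> (k, st \<omega> k) = w !! k" if "k < n" for k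
        using that stake_nth[of k n "W \<omega>"] stake_nth[of k n w] by (simp add: Wn)
      have "\<omega> (k, source S (w !! k)) = w !! k" if "k < n" for k
        using eq[OF that] src(2)[OF \<omega>, of k] by simp
      then show "\<omega> \<in> K.emb (UNIV \<times> states S) J (Pi\<^sub>E J X)"
        using \<omega> by (auto simp: prod_emb_def P_def space_PiM J_def X_def restrict_def PiE_def extensional_def)
    next
      fix \<omega> assume a: "\<omega> \<in> K.emb (UNIV \<times> states S) J (Pi\<^sub>E J X)"
      then have \<omega>: "\<omega> \<in> space P" by (auto simp: prod_emb_def P_def space_PiM)
      have eq: "\<omega> (k, source S (w !! k)) = w !! k" if "k < n" for k
      proof -
        have kJ: "(k, source S (w !! k)) \<in> J" using that by (auto simp: J_def)
        have "restrict \<omega> J \<in> Pi\<^sub>E J X" using a by (simp add: prod_emb_def)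
        from PiE_mem[OF this kJ] show ?thesis using kJ by (simp add: X_def)
      qed
      have "st \<omega> k = source S (w !! k)" if "k < n" for k
        using that
      proof (induction k)
        case 0
        then show ?case using w by (simp add: st0 Exec_def)
      next
        case (Suc k)
        then show ?case using eq[of k] w by (simp add: stS Exec_def)
      qed
      then have "stake n (W \<omega>) = stake n w"
        using eq by (intro nth_equalityI) (auto simp: stake_nth Wn)
      then show "\<omega> \<in> W -` cyl S e \<inter> space P" using \<omega> WE by (auto simp: cyl_def ew)
    qed
    moreover have "K.emb (UNIV \<times> states S) J (Pi\<^sub>E J X) \<in> sets P"
      unfolding P_def using J X by (intro sets_PiM_I) auto
    moreover have "emeasure P (K.emb (UNIV \<times> states S) J (Pi\<^sub>E J X)) = (\<Prod>x\<in>J. emeasure (K x) (X x))"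
      unfolding P_def using J X by (rule K.emeasure_PiM_emb)
    moreover have "(\<Prod>x\<in>J. emeasure (K x) (X x)) = (\<Prod>k<n. ennreal (prob S (w !! k)))"
      unfolding J_def by (subst prod.reindex) (auto simp: inj_on_def X_def Ksing wt)
    moreover have "\<dots> = ennreal (\<Prod>k<n. prob S (w !! k))"
      using wt S by (intro prod_ennreal) (simp add: is_pts_def less_imp_le)
    moreover have "(\<Prod>k<n. prob S (w !! k)) = (\<Prod>t\<leftarrow>e. prob S t)"
      unfolding ew by (induction n) (simp_all add: stake_Suc lessThan_Suc mult.commute del: stake.simps(2))
    ultimately show ?thesis by simp
  qed
  have meas: "W \<in> measurable P (path_measure S)"
    by (rule measurable_sigma_sets[OF se gen]) (use WE main in auto)
  interpret P: prob_space P unfolding P_def by (rule K.prob_space_axioms)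
  show thesis
  proof (rule that[of "distr P (path_measure S) W"])
    show "space (distr P (path_measure S) W) = Exec S" using sp by simp
    show "prob_space (distr P (path_measure S) W)" using meas by (rule P.prob_space_distr)
    fix e assume e: "e \<in> finite_prefixes S"
    have "cyl S e \<in> sets (path_measure S)" using e by (auto simp: se)
    then show "emeasure (distr P (path_measure S) W) (cyl S e) = ennreal (\<Prod>t\<leftarrow>e. prob S t)"
      using main[OF e] meas by (simp add: emeasure_distr)
  qed simp
qed

lemma space_path_measure: "space (path_measure S) = Exec S"
  and sets_path_measure: "sets (path_measure S) = sigma_sets (Exec S) (range (cyl S))"
proof -
  have gen: "cyl S ` finite_prefixes S \<subseteq> Pow (Exec S)" by (auto simp: cyl_def)
  then show "space (path_measure S) = Exec S"
    by (simp add: path_measure_def space_extend_measure)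
  have "cyl S e \<in> insert {} (cyl S ` finite_prefixes S)" for e
  proof (cases "cyl S e = {}")
    case False
    then obtain w where "w \<in> Exec S" "e = stake (length e) w" by (auto simp: cyl_def)
    then have "e \<in> finite_prefixes S" unfolding finite_prefixes_def by blast
    then show ?thesis by blast
  qed simp
  then have "cyl S e \<in> sigma_sets (Exec S) (cyl S ` finite_prefixes S)" for e
    by (metis (no_types, lifting) insertE sigma_sets.Basic sigma_sets.Empty)
  then have "sigma_sets (Exec S) (range (cyl S)) = sigma_sets (Exec S) (cyl S ` finite_prefixes S)"
    by (intro antisym sigma_sets_mono sigma_sets_mono') auto
  with gen show "sets (path_measure S) = sigma_sets (Exec S) (range (cyl S))"
    by (simp add: path_measure_def sets_extend_measure)
qed

lemma emeasure_path_measure_cyl: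
  assumes S: "is_pts S" and e: "e \<in> finite_prefixes S"
  shows "emeasure (path_measure S) (cyl S e) = ennreal (\<Prod>t\<leftarrow>e. prob S t)"
proof -
  obtain N where N: "space N = Exec S" "sets N = sets (path_measure S)"
    "\<And>e. e \<in> finite_prefixes S \<Longrightarrow> emeasure N (cyl S e) = ennreal (\<Prod>t\<leftarrow>e. prob S t)"
    using path_measure_exists[OF S] by metis
  show ?thesis
  proof (rule emeasure_extend_measure[OF path_measure_def[of S], where \<mu>' = "emeasure N"])
    show "positive (sets (path_measure S)) (emeasure N)" by (rule emeasure_positive[of N, unfolded N(2)])
    show "countably_additive (sets (path_measure S)) (emeasure N)"
      by (rule emeasure_countably_additive[of N, unfolded N(2)])
  qed (use N e in \<open>auto simp: cyl_def\<close>)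
qed

lemma prob_space_path_measure:
  assumes S: "is_pts S"
  shows "prob_space (path_measure S)"
proof -
  obtain N where N: "space N = Exec S" "prob_space N"
    using path_measure_exists[OF S] by metis
  then have "Exec S \<noteq> {}" using prob_space.not_empty by force
  then have "[] \<in> finite_prefixes S" unfolding finite_prefixes_def
    by (metis (mono_tags, lifting) CollectI ex_in_conv stake.simps(1))
  from emeasure_path_measure_cyl[OF S this] show ?thesis
    by (intro prob_spaceI) (simp add: cyl_def space_path_measure)
qed

end

theory Submission
  imports Defs
begin

text \<open>
  Truth of a positive formula is monotone in the labels, so a path of \<open>search_pts S T\<close> that enters
  the unlabelled sink satisfies the formula only if every path branching off just before does.
  Paths that never enter the sink are also paths of the violation-free extension and satisfy the
  formula; once such a path visits a state from which the sink is unreachable, every continuation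
  is of this kind. The remaining paths stay forever among the finitely many states from which the
  sink is reachable without ever entering it; by a maximum principle they form a null set.
\<close>

section \<open>Staying forever inside a leaky finite set of transitions\<close>

text \<open>Reachability inside \<open>F\<close> of a state whose transitions in \<open>F\<close>
  miss some mass. For a state of the completed search this means that the sink can be entered from
  it. The inductive form supplies the backward induction of the maximum principle.\<close>

inductive leaky :: "('s, 't, 'a) pts \<Rightarrow> 't set \<Rightarrow> 's \<Rightarrow> bool" for S F where
  now: "out_prob S F s < 1 \<Longrightarrow> leaky S F s"
| step: "t \<in> F \<Longrightarrow> leaky S F (target S t) \<Longrightarrow> leaky S F (source S t)"

text \<open>Every transition of such a list starts in a leaky state, while the state reached at the
  end is unconstrained; hence the value at length 0 is independent of \<open>s\<close>.\<close>

primrec leaky_paths :: "('s, 't, 'a) pts \<Rightarrow> 't set \<Rightarrow> nat \<Rightarrow> 's \<Rightarrow> 't list set" where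
  "leaky_paths S F 0 s = {[]}"
| "leaky_paths S F (Suc n) s = (if leaky S F s
     then \<Union>t\<in>{t \<in> F. source S t = s}. (#) t ` leaky_paths S F n (target S t) else {})"

text \<open>A finite sum rather than a value of \<open>path_measure\<close>: that measure only knows
  paths from the initial state, whereas the recursion below needs every starting state.\<close>

definition stay_prob :: "('s, 't, 'a) pts \<Rightarrow> 't set \<Rightarrow> nat \<Rightarrow> 's \<Rightarrow> real" where
  "stay_prob S F n s = (\<Sum>e\<in>leaky_paths S F n s. \<Prod>t\<leftarrow>e. prob S t)"

lemma finite_leaky_paths: "finite F \<Longrightarrow> finite (leaky_paths S F n s)"
  by (induction n arbitrary: s) auto

lemma leaky_paths_in_lists: "e \<in> leaky_paths S F n s \<Longrightarrow> set e \<subseteq> F"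
  by (induction n arbitrary: s e) (auto split: if_splits, blast)

lemma stay_prob_0: "stay_prob S F 0 s = 1"
  by (simp add: stay_prob_def)

text \<open>First-step decomposition: lists with different heads are disjoint, and the probability
  of the head factors out.\<close>

lemma stay_prob_Suc:
  assumes "finite F"
  shows "stay_prob S F (Suc n) s = (if leaky S F s
    then \<Sum>t | t \<in> F \<and> source S t = s. prob S t * stay_prob S F n (target S t) else 0)"
proof (cases "leaky S F s")
  case True
  have "stay_prob S F (Suc n) s = (\<Sum>t | t \<in> F \<and> source S t = s.
      \<Sum>e\<in>(#) t ` leaky_paths S F n (target S t). \<Prod>t\<leftarrow>e. prob S t)"
    using True assms unfolding stay_prob_def leaky_paths.simps if_P[OF True]
    by (intro sum.UNION_disjoint) (auto simp: finite_leaky_paths)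
  also have "\<dots> = (\<Sum>t | t \<in> F \<and> source S t = s. prob S t * stay_prob S F n (target S t))"
    by (intro sum.cong refl, subst sum.reindex) (auto simp: stay_prob_def sum_distrib_left)
  finally show ?thesis using True by simp
qed (simp add: stay_prob_def)

text \<open>A finite partial sum of a nonnegative series with sum 1; outside the states of
  \<open>S\<close> the sum is empty.\<close>

lemma out_prob_le_1:
  assumes S: "is_pts S" and F: "is_search S F"
  shows "out_prob S F s \<le> 1"
proof (cases "s \<in> states S")
  case True
  have "(prob S has_sum out_prob S F s) {t. t \<in> F \<and> source S t = s}"
    unfolding out_prob_def using F by (intro has_sum_finite) (auto simp: is_search_def)
  moreover have "(prob S has_sum 1) {t \<in> transitions S. source S t = s}"
    using S True by (simp add: is_pts_def)
  ultimately show ?thesis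
    by (rule has_sum_mono_neutral)
      (use S F in \<open>auto simp: is_pts_def is_search_def intro: less_imp_le\<close>)
next
  case False
  then have empty: "{t. t \<in> F \<and> source S t = s} = {}"
    using S F by (auto simp: is_pts_def is_search_def)
  show ?thesis unfolding out_prob_def empty by simp
qed

lemma prob_pos:
  assumes "is_pts S" "is_search S F" "t \<in> F"
  shows "0 < prob S t"
  using assms by (auto simp: is_pts_def is_search_def)

lemma stay_prob_nonneg:
  assumes "is_pts S" "is_search S F"
  shows "0 \<le> stay_prob S F n s"
  unfolding stay_prob_def
  using leaky_paths_in_lists[of _ S F n s] prob_pos[OF assms]
  by (intro sum_nonneg prod_list_nonneg) (fastforce intro: less_imp_le)

lemma stay_prob_decreasing:
  assumes S: "is_pts S" and F: "is_search S F"
  shows "stay_prob S F (Suc n) s \<le> stay_prob S F n s"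
proof (induction n arbitrary: s)
  case 0
  have "finite F" using F by (simp add: is_search_def)
  then show ?case
    using out_prob_le_1[OF S F, of s] by (simp add: stay_prob_Suc stay_prob_0 out_prob_def)
next
  case (Suc n)
  have finF: "finite F" using F by (simp add: is_search_def)
  have "(\<Sum>t | t \<in> F \<and> source S t = s. prob S t * stay_prob S F (Suc n) (target S t))
      \<le> (\<Sum>t | t \<in> F \<and> source S t = s. prob S t * stay_prob S F n (target S t))"
    using Suc prob_pos[OF S F] by (intro sum_mono mult_left_mono) (auto intro: less_imp_le)
  then show ?case
    unfolding stay_prob_Suc[OF finF, of S "Suc n"] stay_prob_Suc[OF finF, of S n s] by simp
qed

text \<open>Maximum principle. A positive maximum cannot be attained where mass is missing, and this
  strictness propagates backwards along transitions of positive probability, hence to all leaky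
  states.\<close>

lemma harmonic_on_leaky_eq_0:
  assumes S: "is_pts S" and F: "is_search S F"
    and q_nonneg: "\<And>s. 0 \<le> q s"
    and q: "\<And>s. q s = (if leaky S F s
      then \<Sum>t | t \<in> F \<and> source S t = s. prob S t * q (target S t) else 0)"
  shows "q s = 0"
proof -
  have finF: "finite F" using F by (simp add: is_search_def)
  \<comment> \<open>Finite, so that \<open>q\<close> has a maximum on it, and containing all targets
    of \<open>F\<close> as well as the state \<open>s\<close> of the claim.\<close>
  define X where "X = insert s (search_states S F)"
  have X: "finite X" "X \<noteq> {}" using finF by (auto simp: X_def search_states_def)
  define m where "m = Max (q ` X)"
  have qt: "q (target S t) \<le> m" if "t \<in> F" for t
    using X that unfolding m_def by (intro Max_ge) (auto simp: X_def search_states_def)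
  have qs: "q s \<le> m" using X unfolding m_def by (intro Max_ge) (auto simp: X_def)
  have bound: "q x \<le> out_prob S F x * m" if "leaky S F x" for x
  proof -
    have "q x = (\<Sum>t | t \<in> F \<and> source S t = x. prob S t * q (target S t))"
      using q[of x] that by simp
    also have "\<dots> \<le> (\<Sum>t | t \<in> F \<and> source S t = x. prob S t * m)"
      using qt prob_pos[OF S F] by (intro sum_mono mult_left_mono) (auto intro: less_imp_le)
    finally show ?thesis by (simp add: out_prob_def sum_distrib_right)
  qed
  have "m \<le> 0"
  proof (rule ccontr)
    assume "\<not> m \<le> 0"
    then have m: "0 < m" by simp
    have lt: "q x < m" if "leaky S F x" for x
      using that
    proof induction
      case (now x)
      then have "out_prob S F x * m < m" using m by simp
      then show ?case using bound[OF leaky.now[OF now]] by linarith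
    next
      case (step t)
      let ?x = "source S t"
      have "q ?x = (\<Sum>u | u \<in> F \<and> source S u = ?x. prob S u * q (target S u))"
        using q[of ?x] leaky.step[OF step(1,2)] by simp
      \<comment> \<open>One strict summand suffices: that of \<open>t\<close>, by the induction
        hypothesis for its target and \<open>0 < prob S t\<close>.\<close>
      also have "\<dots> < (\<Sum>u | u \<in> F \<and> source S u = ?x. prob S u * m)"
      proof (rule sum_strict_mono_ex1)
        show "finite {u. u \<in> F \<and> source S u = ?x}" using finF by simp
        show "\<forall>u\<in>{u. u \<in> F \<and> source S u = ?x}. prob S u * q (target S u) \<le> prob S u * m"
          using qt prob_pos[OF S F] by (auto intro!: mult_left_mono intro: less_imp_le)
        show "\<exists>u\<in>{u. u \<in> F \<and> source S u = ?x}. prob S u * q (target S u) < prob S u * m"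
          using step prob_pos[OF S F] by (intro bexI[of _ t]) auto
      qed
      also have "\<dots> = out_prob S F ?x * m" by (simp add: out_prob_def sum_distrib_right)
      also have "\<dots> \<le> 1 * m" using out_prob_le_1[OF S F] m by (intro mult_right_mono) auto
      finally show ?case by simp
    qed
    \<comment> \<open>Off the leaky states \<open>q\<close> vanishes, so it lies below
      \<open>m\<close> there too and the maximum is attained nowhere.\<close>
    have "q x < m" for x using lt[of x] q[of x] m by (cases "leaky S F x") auto
    moreover have "m \<in> q ` X" unfolding m_def using X by (intro Max_in) auto
    ultimately show False by auto
  qed
  then show ?thesis using qs q_nonneg[of s] by linarith
qed

text \<open>The decreasing nonnegative sequence has a limit \<open>q\<close>. Letting
  \<open>n\<close> tend to infinity in the finite one-step recursion shows that \<open>q\<close>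
  satisfies the equation of the maximum principle.\<close>

lemma stay_prob_tendsto_0:
  assumes S: "is_pts S" and F: "is_search S F"
  shows "(\<lambda>n. stay_prob S F n s) \<longlonglongrightarrow> 0"
proof -
  have finF: "finite F" using F by (simp add: is_search_def)
  define q where "q s = lim (\<lambda>n. stay_prob S F n s)" for s
  have lim: "(\<lambda>n. stay_prob S F n s) \<longlonglongrightarrow> q s" for s
  proof -
    have "decseq (\<lambda>n. stay_prob S F n s)"
      using stay_prob_decreasing[OF S F] by (rule decseq_SucI)
    then have "convergent (\<lambda>n. stay_prob S F n s)"
      using decseq_convergent[of _ 0] stay_prob_nonneg[OF S F] by (metis convergentI)
    then show ?thesis unfolding q_def by (simp add: convergent_LIMSEQ_iff)
  qed
  have "q s = 0"
  proof (rule harmonic_on_leaky_eq_0[OF S F])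
    show "0 \<le> q s" for s
      using lim by (rule LIMSEQ_le_const) (use stay_prob_nonneg[OF S F] in auto)
    show "q s = (if leaky S F s
      then \<Sum>t | t \<in> F \<and> source S t = s. prob S t * q (target S t) else 0)" for s
    proof (rule LIMSEQ_unique)
      show "(\<lambda>n. stay_prob S F (Suc n) s) \<longlonglongrightarrow> q s" using lim by (rule LIMSEQ_Suc)
      show "(\<lambda>n. stay_prob S F (Suc n) s) \<longlonglongrightarrow> (if leaky S F s
        then \<Sum>t | t \<in> F \<and> source S t = s. prob S t * q (target S t) else 0)"
        using lim by (auto simp: stay_prob_Suc[OF finF] intro!: tendsto_sum tendsto_mult)
    qed
  qed
  then show ?thesis using lim[of s] by simp
qed

section \<open>The executions that stay leaky forever: measurability and measure zero\<close>

definition leaky_execs :: "('s, 't, 'a) pts \<Rightarrow> 't set \<Rightarrow> 't stream set" where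
  "leaky_execs S F = {w \<in> Exec S. \<forall>n. w !! n \<in> F \<and> leaky S F (source S (w !! n))}"

lemma cyl_in_sets_path_measure: "cyl S e \<in> sets (path_measure S)"
  by (auto simp: sets_path_measure)

text \<open>The condition concerns each position separately, so the set is a countable intersection,
  over the prefix length, of finite unions of cylinders.\<close>

lemma leaky_execs_in_sets:
  assumes "finite F"
  shows "leaky_execs S F \<in> sets (path_measure S)"
proof -
  define G where "G = {t \<in> F. leaky S F (source S t)}"
  have finG: "finite G" using assms by (simp add: G_def)
  have "leaky_execs S F = (\<Inter>n. \<Union>e\<in>{e. set e \<subseteq> G \<and> length e = n}. cyl S e)"
  proof (intro set_eqI iffI)
    fix w assume w: "w \<in> leaky_execs S F"
    have "stake n w \<in> {e. set e \<subseteq> G \<and> length e = n}" for n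
      using w by (auto simp: leaky_execs_def G_def in_set_conv_nth)
    moreover have "w \<in> cyl S (stake n w)" for n
      using w by (simp add: leaky_execs_def cyl_def)
    ultimately show "w \<in> (\<Inter>n. \<Union>e\<in>{e. set e \<subseteq> G \<and> length e = n}. cyl S e)" by blast
  next
    fix w assume "w \<in> (\<Inter>n. \<Union>e\<in>{e. set e \<subseteq> G \<and> length e = n}. cyl S e)"
    then have w: "w \<in> Exec S" "set (stake n w) \<subseteq> G" for n by (auto simp: cyl_def)
    \<comment> \<open>Position \<open>n\<close> is first visible in the prefix of length
      \<open>Suc n\<close>.\<close>
    have "w !! n \<in> G" for n
      using w(2)[of "Suc n"] nth_mem[of n "stake (Suc n) w"] by (auto simp del: stake.simps)
    then show "w \<in> leaky_execs S F" using w(1) by (auto simp: leaky_execs_def G_def)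
  qed
  then show ?thesis
    using finite_lists_length_eq[OF finG]
    by (auto intro!: sets.countable_INT sets.finite_UN cyl_in_sets_path_measure)
qed

text \<open>Formulated for streams rather than executions because the induction passes to the tail,
  which need not start in the initial state.\<close>

lemma stake_in_leaky_paths:
  assumes "\<And>n. w !! n \<in> F" "\<And>n. leaky S F (source S (w !! n))"
    "\<And>n. target S (w !! n) = source S (w !! Suc n)"
  shows "stake n w \<in> leaky_paths S F n (source S (shd w))"
  using assms
proof (induction n arbitrary: w)
  case (Suc n)
  have "stake n (stl w) \<in> leaky_paths S F n (source S (shd (stl w)))"
    using Suc.prems by (intro Suc.IH) (metis snth.simps(2))+
  then show ?case
    using Suc.prems(1)[of 0] Suc.prems(2)[of 0] Suc.prems(3)[of 0] by auto
qed simp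

text \<open>A list that is no prefix of an execution has an empty cylinder, so the bound applies
  without asking which lists extend to executions.\<close>

lemma emeasure_cyl_le:
  assumes "is_pts S"
  shows "emeasure (path_measure S) (cyl S e) \<le> ennreal (\<Prod>t\<leftarrow>e. prob S t)"
proof (cases "cyl S e = {}")
  case False
  then obtain w where "w \<in> Exec S" "e = stake (length e) w" by (auto simp: cyl_def)
  then have "e \<in> finite_prefixes S" unfolding finite_prefixes_def by blast
  then show ?thesis using emeasure_path_measure_cyl[OF assms] by simp
qed simp

text \<open>For each \<open>n\<close> the cylinders of the lists in \<open>leaky_paths\<close> cover
  the set, and their measures add up to at most \<open>stay_prob\<close>, which tends to 0.\<close>

lemma leaky_execs_null:
  assumes S: "is_pts S" and F: "is_search S F"
  shows "leaky_execs S F \<in> null_sets (path_measure S)"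
proof -
  have finF: "finite F" using F by (simp add: is_search_def)
  let ?\<mu> = "emeasure (path_measure S)" and ?E = "\<lambda>n. leaky_paths S F n (initial S)"
  have le: "?\<mu> (leaky_execs S F) \<le> ennreal (stay_prob S F n (initial S))" for n
  proof -
    have "leaky_execs S F \<subseteq> (\<Union>e\<in>?E n. cyl S e)"
    proof
      fix w assume w: "w \<in> leaky_execs S F"
      then have "stake n w \<in> ?E n"
        using stake_in_leaky_paths[of w F S n] by (auto simp: leaky_execs_def Exec_def)
      moreover have "w \<in> cyl S (stake n w)" using w by (simp add: leaky_execs_def cyl_def)
      ultimately show "w \<in> (\<Union>e\<in>?E n. cyl S e)" by blast
    qed
    then have "?\<mu> (leaky_execs S F) \<le> ?\<mu> (\<Union>e\<in>?E n. cyl S e)"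
      using finF by (intro emeasure_mono sets.finite_UN finite_leaky_paths cyl_in_sets_path_measure)
    also have "\<dots> \<le> (\<Sum>e\<in>?E n. ?\<mu> (cyl S e))"
      using finF by (intro emeasure_subadditive_finite finite_leaky_paths)
        (auto simp: cyl_in_sets_path_measure)
    also have "\<dots> \<le> (\<Sum>e\<in>?E n. ennreal (\<Prod>t\<leftarrow>e. prob S t))"
      using S by (intro sum_mono emeasure_cyl_le)
    also have "\<dots> = ennreal (stay_prob S F n (initial S))"
      unfolding stay_prob_def
      using leaky_paths_in_lists[of _ S F n "initial S"] prob_pos[OF S F]
      by (intro sum_ennreal prod_list_nonneg) (fastforce intro: less_imp_le)
    finally show ?thesis .
  qed
  have "(\<lambda>n. ennreal (stay_prob S F n (initial S))) \<longlonglongrightarrow> ennreal 0"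
    using stay_prob_tendsto_0[OF S F] by (rule tendsto_ennrealI)
  then have "?\<mu> (leaky_execs S F) \<le> ennreal 0"
    by (rule LIMSEQ_le_const) (use le in auto)
  then show ?thesis using leaky_execs_in_sets[OF finF] by (auto simp: null_sets_def)
qed

section \<open>Paths of the completed search\<close>

text \<open>Without negation every operator is monotone. Both words vary in the induction because
  the temporal operators pass to suffixes.\<close>

lemma ltl_sat_mono:
  assumes "ltl_sat f x" "\<And>n. x !! n \<subseteq> y !! n"
  shows "ltl_sat f y"
  using assms
proof (induction f arbitrary: x y)
  case (LAnd f g)
  then show ?case using LAnd.IH(1)[of x y] LAnd.IH(2)[of x y] by simp
next
  case (LOr f g)
  then show ?case using LOr.IH(1)[of x y] LOr.IH(2)[of x y] by auto
next
  case (LAtom a)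
  from LAtom(2)[of 0] LAtom(1) show ?case by auto
next
  case (LNext f)
  have "stl x !! n \<subseteq> stl y !! n" for n using LNext.prems(2)[of "Suc n"] by simp
  then show ?case using LNext.IH[of "stl x" "stl y"] LNext.prems(1) by simp
next
  case (LUntil f g)
  have "sdrop k x !! n \<subseteq> sdrop k y !! n" for k n using LUntil.prems(2) by (simp add: sdrop_snth)
  then have "ltl_sat f (sdrop k x) \<Longrightarrow> ltl_sat f (sdrop k y)"
    "ltl_sat g (sdrop k x) \<Longrightarrow> ltl_sat g (sdrop k y)" for k
    using LUntil.IH[of "sdrop k x" "sdrop k y"] by auto
  then show ?case using LUntil.prems(1) unfolding ltl_sat.simps by metis
next
  case (LRelease f g)
  have "sdrop k x !! n \<subseteq> sdrop k y !! n" for k n using LRelease.prems(2) by (simp add: sdrop_snth)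
  then have "ltl_sat f (sdrop k x) \<Longrightarrow> ltl_sat f (sdrop k y)"
    "ltl_sat g (sdrop k x) \<Longrightarrow> ltl_sat g (sdrop k y)" for k
    using LRelease.IH[of "sdrop k x" "sdrop k y"] by auto
  then show ?case using LRelease.prems(1) unfolding ltl_sat.simps by metis
qed simp_all

section \<open>Executions sharing a finite prefix\<close>

lemma Exec_snth:
  assumes "w \<in> Exec S"
  shows "w !! n \<in> transitions S" "source S (w !! 0) = initial S"
    "target S (w !! n) = source S (w !! Suc n)"
  using assms snth_sset[of w n] by (auto simp: Exec_def)

lemma cyl_stake_snth:
  assumes "w' \<in> cyl S (stake n w)" "k < n"
  shows "w' !! k = w !! k"
  using assms stake_nth[of k n w'] stake_nth[of k n w] by (simp add: cyl_def)

text \<open>The case \<open>k = n\<close> is included: \<open>n\<close> transitions determine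
  \<open>n + 1\<close> states, the last being the target of the last transition, or the initial
  state if \<open>n = 0\<close>.\<close>

lemma cyl_stake_source:
  assumes "w \<in> Exec S" "w' \<in> cyl S (stake n w)" "k \<le> n"
  shows "source S (w' !! k) = source S (w !! k)"
proof (cases k)
  case 0
  then show ?thesis using Exec_snth(2)[of w S] Exec_snth(2)[of w' S] assms by (simp add: cyl_def)
next
  case (Suc l)
  then have "w' !! l = w !! l" using assms by (intro cyl_stake_snth) auto
  then show ?thesis
    using Suc Exec_snth(3)[of w S l] Exec_snth(3)[of w' S l] assms by (simp add: cyl_def)
qed

lemma good_pathsI:
  assumes "w \<in> Exec S" "\<And>k. k < n \<Longrightarrow> w !! k \<in> T"
    "\<And>w'. w' \<in> cyl S (stake n w) \<Longrightarrow> satisfies S w' P"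
  shows "w \<in> good_paths S T P"
proof -
  have "stake n w \<in> lists T" using assms(2) by (auto simp: in_set_conv_nth)
  moreover have "w \<in> cyl S (stake n w)" using assms(1) by (simp add: cyl_def)
  ultimately show ?thesis using assms(3) unfolding good_paths_def by blast
qed

section \<open>Executions of the completed search inside and outside the found transitions\<close>

lemma is_search_search_pts:
  assumes "is_search S T"
  shows "is_search (search_pts S T) (Found ` T)"
  using assms by (auto simp: is_search_def search_pts_def)

lemma out_prob_search_pts:
  "out_prob (search_pts S T) (Found ` T) (Some s) = out_prob S T s"
proof -
  have "{u. u \<in> Found ` T \<and> source (search_pts S T) u = Some s}
      = Found ` {t. t \<in> T \<and> source S t = s}"
    by (auto simp: search_pts_def)
  then show ?thesis
    unfolding out_prob_def by (simp add: sum.reindex inj_on_def) (simp add: search_pts_def)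
qed

text \<open>Such a path uses only data that every extension preserves, so it is carried over to an
  execution of \<open>S'\<close> with the same trace.\<close>

lemma search_pts_Found_path_satisfies:
  assumes S': "extends_via Inl Inl S T S'" "\<And>w. w \<in> Exec S' \<Longrightarrow> satisfies S' w P"
    and w: "w \<in> Exec (search_pts S T)" "\<And>n. w !! n \<in> Found ` T"
  shows "satisfies (search_pts S T) w P"
proof -
  \<comment> \<open>The \<open>case\<close> is specified only for \<open>Found\<close>; by
    \<open>w(2)\<close> no other constructor occurs in \<open>w\<close>.\<close>
  define v where "v = smap (\<lambda>u. case u of Found t \<Rightarrow> t) w"
  have v: "w !! n = Found (v !! n)" "v !! n \<in> T" for n
    using w(2)[of n] by (auto simp: v_def)
  have src: "source S' (Inl t) = Inl (source S t)" "target S' (Inl t) = Inl (target S t)"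
    "Inl t \<in> transitions S'" "label S' (Inl (source S t)) = label S (source S t)"
    if "t \<in> T" for t
    using S'(1) that by (auto simp: extends_via_def)
  have "smap Inl v \<in> Exec S'"
    unfolding Exec_def
  proof (intro CollectI conjI allI)
    show "sset (smap Inl v) \<subseteq> transitions S'" using src v by (auto simp: sset_range)
    show "source S' (shd (smap Inl v)) = initial S'"
      using Exec_snth(2)[OF w(1)] src(1)[OF v(2)[of 0]] v(1)[of 0] S'(1)
      by (simp add: search_pts_def extends_via_def)
    show "target S' (smap Inl v !! n) = source S' (smap Inl v !! Suc n)" for n
      using Exec_snth(3)[OF w(1), of n] src(1)[OF v(2)[of "Suc n"]] src(2)[OF v(2)[of n]]
        v(1)[of n] v(1)[of "Suc n"]
      by (simp add: search_pts_def del: snth.simps)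
  qed
  moreover have "path_trace S' (smap Inl v) !! n = path_trace (search_pts S T) w !! n" for n
    using src[OF v(2)[of n]] v(1)[of n] by (simp add: path_trace_def) (simp add: search_pts_def)
  then have "path_trace S' (smap Inl v) = path_trace (search_pts S T) w"
    by (metis smap_alt stream.map_id0 id_apply)
  ultimately show ?thesis using S'(2) by (metis satisfies_def)
qed

text \<open>Being non-leaky is invariant: such a state has no \<open>Missing\<close> transition, and
  a leaky successor along a found transition would make the state itself leaky.\<close>

lemma search_pts_exec_not_leaky:
  assumes w: "w \<in> Exec (search_pts S T)"
    and n: "source (search_pts S T) (w !! n) = Some s" "\<not> leaky (search_pts S T) (Found ` T) (Some s)"
  shows "w !! (n + k) \<in> Found ` T"
proof -
  let ?M = "search_pts S T"
  have Found: "w !! m \<in> Found ` T"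
    if "source ?M (w !! m) = Some x" "\<not> leaky ?M (Found ` T) (Some x)" for m x
  proof -
    have "\<not> out_prob S T x < 1"
      using that(2) leaky.now[of ?M "Found ` T" "Some x"] by (auto simp: out_prob_search_pts)
    then show ?thesis using that(1) Exec_snth(1)[OF w, of m] by (auto simp: search_pts_def)
  qed
  have "\<exists>x. source ?M (w !! (n + k)) = Some x \<and> \<not> leaky ?M (Found ` T) (Some x)"
  proof (induction k)
    case 0
    then show ?case using n by simp
  next
    case (Suc k)
    then obtain x where x: "source ?M (w !! (n + k)) = Some x" "\<not> leaky ?M (Found ` T) (Some x)"
      by blast
    then obtain t where t: "w !! (n + k) = Found t" "t \<in> T" using Found by blast
    have tgt: "source ?M (w !! (n + Suc k)) = target ?M (Found t)"
      using Exec_snth(3)[OF w, of "n + k"] t by simp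
    moreover have "target ?M (Found t) = Some (target S t)" by (simp add: search_pts_def)
    moreover have "\<not> leaky ?M (Found ` T) (target ?M (Found t))"
      using leaky.step[of "Found t" "Found ` T" ?M] x t by auto
    ultimately show ?case by auto
  qed
  then show ?thesis using Found by blast
qed

text \<open>Every transition that is not a found one ends in the sink, whose only outgoing
  transition is the loop. The conclusion starts at \<open>Suc n\<close>, since position
  \<open>n\<close> may still have a labelled source.\<close>

lemma search_pts_leaving_exec:
  assumes w: "w \<in> Exec (search_pts S T)"
    and n: "w !! n \<notin> Found ` T" "\<And>k. k < n \<Longrightarrow> w !! k \<in> Found ` T"
  shows "w !! (Suc n + k) = Sink_Loop"
proof -
  let ?M = "search_pts S T"
  have next_sink: "w !! Suc m = Sink_Loop" if "target ?M (w !! m) = None" for m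
    using that Exec_snth(1)[OF w, of "Suc m"] Exec_snth(3)[OF w, of m]
    by (auto simp: search_pts_def)
  have "target ?M (w !! (n + k)) = None"
  proof (induction k)
    case 0
    show ?case using n(1) Exec_snth(1)[OF w, of n] by (auto simp: search_pts_def)
  next
    case (Suc k)
    then show ?case using next_sink[OF Suc] by (simp add: search_pts_def)
  qed
  then show ?thesis using next_sink[of "n + k"] by simp
qed

lemma satisfying_exec_good_or_leaky:
  assumes S': "extends_via Inl Inl S T S'" "\<And>w. w \<in> Exec S' \<Longrightarrow> satisfies S' w (models f)"
    and w: "w \<in> Exec (search_pts S T)" "satisfies (search_pts S T) w (models f)"
  shows "w \<in> good_paths (search_pts S T) (Found ` T) (models f)
    \<union> leaky_execs (search_pts S T) (Found ` T)"
proof -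
  let ?M = "search_pts S T"
  consider (leave) "\<exists>n. w !! n \<notin> Found ` T"
    | (stay) n where "\<And>n. w !! n \<in> Found ` T" "\<not> leaky ?M (Found ` T) (source ?M (w !! n))"
    | (leaky) "w \<in> leaky_execs ?M (Found ` T)"
    using w(1) by (auto simp: leaky_execs_def)
  then show ?thesis
  proof cases
    case leave
    \<comment> \<open>The first departure is taken so that the prefix before it is a word over the
      found transitions, as \<open>good_paths\<close> demands.\<close>
    define n where "n = (LEAST n. w !! n \<notin> Found ` T)"
    have n: "w !! n \<notin> Found ` T" "\<And>k. k < n \<Longrightarrow> w !! k \<in> Found ` T"
      using LeastI_ex[OF leave] not_less_Least[of _ "\<lambda>n. w !! n \<notin> Found ` T"]
      by (auto simp: n_def)
    have "w \<in> good_paths ?M (Found ` T) (models f)"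
    proof (rule good_pathsI[OF w(1) n(2)])
      fix w' assume w': "w' \<in> cyl ?M (stake n w)"
      \<comment> \<open>Up to and including position \<open>n\<close> both paths visit the same
        states; afterwards \<open>w\<close> sits in the sink with empty labels. Monotonicity then
        passes the formula from \<open>w\<close> to \<open>w'\<close>.\<close>
      have "path_trace ?M w !! k \<subseteq> path_trace ?M w' !! k" for k
      proof (cases "k \<le> n")
        case True
        then show ?thesis using cyl_stake_source[OF w(1) w'] by (simp add: path_trace_def)
      next
        case False
        then have "w !! k = Sink_Loop"
          using search_pts_leaving_exec[OF w(1) n, of "k - Suc n"] by simp
        then show ?thesis by (simp add: path_trace_def) (simp add: search_pts_def)
      qed
      then show "satisfies ?M w' (models f)"
        using w(2) ltl_sat_mono[of f "path_trace ?M w" "path_trace ?M w'"]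
        by (simp add: satisfies_def models_def)
    qed
    then show ?thesis by simp
  next
    case stay
    obtain t where t: "w !! n = Found t" using stay(1)[of n] by blast
    then have src: "source ?M (w !! n) = Some (source S t)" by (simp add: search_pts_def)
    have "w \<in> good_paths ?M (Found ` T) (models f)"
    \<comment> \<open>The prefix ends on reaching the non-leaky state. Any \<open>w'\<close> sharing
      it is in that state at position \<open>n\<close> and thus uses only found transitions
      throughout.\<close>
    proof (rule good_pathsI[OF w(1) stay(1)])
      fix w' assume w': "w' \<in> cyl ?M (stake n w)"
      then have E: "w' \<in> Exec ?M" by (simp add: cyl_def)
      have "source ?M (w' !! n) = Some (source S t)"
        using cyl_stake_source[OF w(1) w', of n] src by simp
      then have ge: "w' !! (n + k) \<in> Found ` T" for k
        using search_pts_exec_not_leaky[OF E] stay(2) src by simp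
      have "w' !! k \<in> Found ` T" for k
      proof (cases "k < n")
        case True
        then show ?thesis using cyl_stake_snth[OF w'] stay(1) by simp
      next
        case False
        then show ?thesis using ge[of "k - n"] by simp
      qed
      then show "satisfies ?M w' (models f)"
        using search_pts_Found_path_satisfies[OF S' E] by blast
    qed
    then show ?thesis by simp
  qed simp
qed

text \<open>There are only countably many finite words over \<open>T\<close>, hence a countable
  union of cylinders.\<close>

lemma good_paths_in_sets:
  assumes "countable T"
  shows "good_paths S T P \<in> sets (path_measure S)"
proof -
  have "{cyl S e | e. e \<in> lists T \<and> (\<forall>w\<in>cyl S e. satisfies S w P)} \<subseteq> cyl S ` lists T" by blast
  then have "countable {cyl S e | e. e \<in> lists T \<and> (\<forall>w\<in>cyl S e. satisfies S w P)}"
    by (rule countable_subset) (use assms in auto)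
  then show ?thesis
    unfolding good_paths_def 
    by (intro sets.countable_Union) (auto simp: cyl_in_sets_path_measure)
qed

theorem theorem3:
  fixes S :: "('s, 't, 'a) pts" and T :: "'t set" and \<phi> :: "'a ltl_pos"
  assumes "is_pts S"
    and "is_search S T"
    and "no_violation_found S T (models \<phi>)"
  shows "emeasure (path_measure (search_pts S T))
           (good_paths (search_pts S T) (Found ` T) (models \<phi>))
       = emeasure (path_measure (search_pts S T))
           {e \<in> Exec (search_pts S T). satisfies (search_pts S T) e (models \<phi>)}"
proof -
  let ?M = "search_pts S T"
  let ?G = "good_paths ?M (Found ` T) (models \<phi>)" and ?N = "leaky_execs ?M (Found ` T)"
  obtain S' :: "('s + nat, 't + nat, 'a) pts"
    where S': "extends_via Inl Inl S T S'" "\<And>w. w \<in> Exec S' \<Longrightarrow> satisfies S' w (models \<phi>)"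
    using assms(3) by (auto simp: no_violation_found_def)
  \<comment> \<open>An exact equality: the leaky executions satisfy the formula as well, since they
    consist of found transitions and transfer to \<open>S'\<close>. So the two sides of the claim
    differ by a null set.\<close>
  have "{e \<in> Exec ?M. satisfies ?M e (models \<phi>)} = ?G \<union> ?N"
  proof (intro antisym subsetI)
    fix w assume "w \<in> ?G \<union> ?N"
    then show "w \<in> {e \<in> Exec ?M. satisfies ?M e (models \<phi>)}"
      using search_pts_Found_path_satisfies[OF S', of w]
      by (auto simp: good_paths_def leaky_execs_def cyl_def)
  qed (use satisfying_exec_good_or_leaky[OF S'] in blast)
  moreover have "?N \<in> null_sets (path_measure ?M)"
    using assms by (intro leaky_execs_null is_pts_search_pts is_search_search_pts)
  moreover have "?G \<in> sets (path_measure ?M)"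
    using assms(2) by (intro good_paths_in_sets) (simp add: is_search_def countable_finite)
  ultimately show ?thesis by (simp add: emeasure_Un_null_set)
qed

end
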